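(* Let $A$ be a unital separable $C^*$-algebra, let $S\subset A$ be an operator system with $C^*(S)=A$, and let $\varphi$ be a state of $A$ with GNS representation $(\pi_\varphi,H_\varphi,\xi_\varphi)$. Then $\pi_\varphi$ has the unique tight extension property with respect to $S$ if and only if $\varphi$ is maximal in the strong dilation relation $\preceq_{\mathrm S}$ associated with the pair $(S,A)$.
   Context: An operator system in $A$ is a unital self-adjoint linear subspace of $A$ (not assumed closed); $C^*(S)$ is the $C^*$-subalgebra generated by $S$. $\mathcal E(A)$ denotes the state space of $A$. Representations are unital $*$-representations on Hilbert spaces, and UCP means unital completely positive. For $\varphi\in\mathcal E(A)$, the GNS representation $(\pi_\varphi,H_\varphi,\xi_\varphi)$ satisfies $\varphi(a)=\langle\pi_\varphi(a)\xi_\varphi,\xi_\varphi\rangle$ and $H_\varphi=\overline{\pi_\varphi(A)\xi_\varphi}$. A representation $\pi:A\to B(H)$ has the unique tight extension property with respect to $S$ if the only UCP map $\Phi:A\to\pi(A)''$ with $\Phi|_S=\pi|_S$ is $\Phi=\pi$ (here $\pi(A)''$ is the bicommutant). Strong dilation relation: for $\varphi,\psi\in\mathcal E(A)$, $\varphi\preceq_{\mathrm S}\psi$ if there exists a UCP map $\Phi:A\to\pi_\varphi(A)''$ such that $\Phi(s)=\pi_\varphi(s)$ for all $s\in S$ and $\psi(a)=\langle\Phi(a)\xi_\varphi,\xi_\varphi\rangle$ for all $a\in A$. A state $\varphi$ is maximal in $\preceq_{\mathrm S}$ if $\varphi\preceq_{\mathrm S}\psi$ implies $\psi=\varphi$ for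 every $\psi\in\mathcal E(A)$. *)

theory Defs
  imports "HOL-Analysis.Analysis"
begin

class complex_normed_space = real_normed_vector +
  fixes scaleC :: "complex \<Rightarrow> 'a \<Rightarrow> 'a"  (infixr "*\<^sub>C" 75)
  assumes scaleC_add_right: "c *\<^sub>C (x + y) = c *\<^sub>C x + c *\<^sub>C y"
    and scaleC_add_left: "(c + d) *\<^sub>C x = c *\<^sub>C x + d *\<^sub>C x"
    and scaleC_scaleC: "c *\<^sub>C d *\<^sub>C x = (c * d) *\<^sub>C x"
    and scaleC_of_real: "complex_of_real r *\<^sub>C x = r *\<^sub>R x"
    and norm_scaleC: "norm (c *\<^sub>C x) = cmod c * norm x"

text \<open>The inner product is linear in its first argument, so that
  \<open>a \<mapsto> cinner (\<pi> a \<xi>) \<xi>\<close> is linear.\<close>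

class complex_hilbert_space = complex_normed_space + banach +
  fixes cinner :: "'a \<Rightarrow> 'a \<Rightarrow> complex"
  assumes cinner_add_left: "cinner (x + y) z = cinner x z + cinner y z"
    and cinner_scaleC_left: "cinner (c *\<^sub>C x) y = c * cinner x y"
    and cinner_commute: "cinner y x = cnj (cinner x y)"
    and cinner_self: "cinner x x = complex_of_real ((norm x)\<^sup>2)"

definition clinear :: "('a::complex_normed_space \<Rightarrow> 'b::complex_normed_space) \<Rightarrow> bool" where
  "clinear f \<longleftrightarrow> (\<forall>x y. f (x + y) = f x + f y) \<and> (\<forall>c x. f (c *\<^sub>C x) = c *\<^sub>C f x)"

definition csubspace :: "'a::complex_normed_space set \<Rightarrow> bool" where
  "csubspace V \<longleftrightarrow> 0 \<in> V \<and> (\<forall>x\<in>V. \<forall>y\<in>V. x + y \<in> V) \<and> (\<forall>c. \<forall>x\<in>V. c *\<^sub>C x \<in> V)"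

text \<open>The class \<open>real_normed_algebra_1\<close> excludes the zero algebra, which has no states.\<close>

class unital_cstar_algebra = complex_normed_space + real_normed_algebra_1 + banach +
  fixes star :: "'a \<Rightarrow> 'a"
  assumes mult_scaleC_left: "(c *\<^sub>C x) * y = c *\<^sub>C (x * y)"
    and mult_scaleC_right: "x * (c *\<^sub>C y) = c *\<^sub>C (x * y)"
    and star_star: "star (star x) = x"
    and star_add: "star (x + y) = star x + star y"
    and star_scaleC: "star (c *\<^sub>C x) = cnj c *\<^sub>C star x"
    and star_mult: "star (x * y) = star y * star x"
    and cstar_identity: "norm (star x * x) = (norm x)\<^sup>2"

instantiation complex :: "{complex_hilbert_space, unital_cstar_algebra}"
begin

definition scaleC_complex :: "complex \<Rightarrow> complex \<Rightarrow> complex" where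
  "scaleC_complex c x = c * x"

definition cinner_complex :: "complex \<Rightarrow> complex \<Rightarrow> complex" where
  "cinner_complex x y = x * cnj y"

definition star_complex :: "complex \<Rightarrow> complex" where
  "star_complex x = cnj x"

instance
proof
  fix x :: complex
  show "cinner x x = complex_of_real ((norm x)\<^sup>2)"
    unfolding cinner_complex_def by (rule complex_norm_square [symmetric])
  show "norm (star x * x) = (norm x)\<^sup>2"
    by (simp add: star_complex_def norm_mult power2_eq_square)
qed (simp_all add: scaleC_complex_def cinner_complex_def star_complex_def algebra_simps
    norm_mult scaleR_conv_of_real)

end

definition separable_type :: "'a::topological_space itself \<Rightarrow> bool" where
  "separable_type _ \<longleftrightarrow> (\<exists>D::'a set. countable D \<and> closure D = UNIV)"

definition cstar_subalgebra :: "'a::unital_cstar_algebra set \<Rightarrow> bool" where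
  "cstar_subalgebra B \<longleftrightarrow> csubspace B \<and> closed B
     \<and> (\<forall>x\<in>B. \<forall>y\<in>B. x * y \<in> B) \<and> (\<forall>x\<in>B. star x \<in> B)"

definition cstar_generated :: "'a::unital_cstar_algebra set \<Rightarrow> 'a set" where
  "cstar_generated S = \<Inter>{B. cstar_subalgebra B \<and> S \<subseteq> B}"

definition operator_system :: "'a::unital_cstar_algebra set \<Rightarrow> bool" where
  "operator_system S \<longleftrightarrow> csubspace S \<and> 1 \<in> S \<and> (\<forall>s\<in>S. star s \<in> S)"

definition state :: "('a::unital_cstar_algebra \<Rightarrow> complex) \<Rightarrow> bool" where
  "state \<phi> \<longleftrightarrow> clinear \<phi> \<and> (\<forall>a. \<phi> (star a * a) \<in> \<real>\<^sub>\<ge>\<^sub>0) \<and> \<phi> 1 = 1"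

definition bounded_op :: "('h::complex_hilbert_space \<Rightarrow> 'h) \<Rightarrow> bool" where
  "bounded_op T \<longleftrightarrow> clinear T \<and> (\<exists>K. \<forall>x. norm (T x) \<le> K * norm x)"

definition commutant :: "('h::complex_hilbert_space \<Rightarrow> 'h) set \<Rightarrow> ('h \<Rightarrow> 'h) set" where
  "commutant M = {T. bounded_op T \<and> (\<forall>X\<in>M. T \<circ> X = X \<circ> T)}"

abbreviation bicommutant :: "('h::complex_hilbert_space \<Rightarrow> 'h) set \<Rightarrow> ('h \<Rightarrow> 'h) set" where
  "bicommutant M \<equiv> commutant (commutant M)"

definition linear_into_ops ::
    "('a::complex_normed_space \<Rightarrow> 'h::complex_hilbert_space \<Rightarrow> 'h) \<Rightarrow> bool" where
  "linear_into_ops \<Phi> \<longleftrightarrow> (\<forall>a. bounded_op (\<Phi> a)) \<and> (\<forall>h. clinear (\<lambda>a. \<Phi> a h))"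

text \<open>The last conjunct says that \<open>\<pi> (star a)\<close> is the Hilbert space adjoint of \<open>\<pi> a\<close>.\<close>

definition representation ::
    "('a::unital_cstar_algebra \<Rightarrow> 'h::complex_hilbert_space \<Rightarrow> 'h) \<Rightarrow> bool" where
  "representation \<pi> \<longleftrightarrow> linear_into_ops \<pi> \<and> \<pi> 1 = id
     \<and> (\<forall>a b. \<pi> (a * b) = \<pi> a \<circ> \<pi> b)
     \<and> (\<forall>a x y. cinner (\<pi> a x) y = cinner x (\<pi> (star a) y))"

text \<open>Given a state \<open>\<phi>\<close>, a GNS triple is \<open>(\<pi>, H, \<xi>)\<close> with \<open>H\<close> the Hilbert space carried
  by the type \<open>'h\<close>; it is determined by \<open>\<phi>\<close> up to unitary equivalence.\<close>

definition gns_representation ::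
    "('a::unital_cstar_algebra \<Rightarrow> complex) \<Rightarrow> ('a \<Rightarrow> 'h \<Rightarrow> 'h) \<Rightarrow> 'h::complex_hilbert_space \<Rightarrow> bool" where
  "gns_representation \<phi> \<pi> \<xi> \<longleftrightarrow> representation \<pi>
     \<and> (\<forall>a. \<phi> a = cinner (\<pi> a \<xi>) \<xi>)
     \<and> closure (range (\<lambda>a. \<pi> a \<xi>)) = UNIV"

text \<open>An \<open>n \<times> n\<close> matrix is a function of two indices, of which only the values below \<open>n\<close> matter.
  Positivity in the C*-algebra of \<open>n \<times> n\<close> matrices over \<open>'a\<close> means being of the form
  \<open>X\<^sup>* X\<close>; a matrix of operators on \<open>H\<close> is positive as an operator on the \<open>n\<close>-fold direct sum
  of \<open>H\<close>.\<close>

definition matrix_positive :: "nat \<Rightarrow> (nat \<Rightarrow> nat \<Rightarrow> 'a::unital_cstar_algebra) \<Rightarrow> bool" where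
  "matrix_positive n a \<longleftrightarrow>
     (\<exists>X. \<forall>i<n. \<forall>j<n. a i j = (\<Sum>k<n. star (X k i) * X k j))"

definition op_matrix_positive ::
    "nat \<Rightarrow> (nat \<Rightarrow> nat \<Rightarrow> 'h \<Rightarrow> 'h::complex_hilbert_space) \<Rightarrow> bool" where
  "op_matrix_positive n T \<longleftrightarrow>
     (\<forall>h. (\<Sum>i<n. cinner (\<Sum>j<n. T i j (h j)) (h i)) \<in> \<real>\<^sub>\<ge>\<^sub>0)"

definition ucp_into :: "('h::complex_hilbert_space \<Rightarrow> 'h) set
    \<Rightarrow> ('a::unital_cstar_algebra \<Rightarrow> 'h \<Rightarrow> 'h) \<Rightarrow> bool" where
  "ucp_into M \<Phi> \<longleftrightarrow> linear_into_ops \<Phi> \<and> range \<Phi> \<subseteq> M \<and> \<Phi> 1 = id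
     \<and> (\<forall>n a. matrix_positive n a \<longrightarrow> op_matrix_positive n (\<lambda>i j. \<Phi> (a i j)))"

definition unique_tight_extension ::
    "'a::unital_cstar_algebra set \<Rightarrow> ('a \<Rightarrow> 'h::complex_hilbert_space \<Rightarrow> 'h) \<Rightarrow> bool" where
  "unique_tight_extension S \<pi> \<longleftrightarrow>
     (\<forall>\<Phi>. ucp_into (bicommutant (range \<pi>)) \<Phi> \<and> (\<forall>s\<in>S. \<Phi> s = \<pi> s) \<longrightarrow> \<Phi> = \<pi>)"

text \<open>The relation between states \<open>\<phi>\<close> and \<open>\<psi>\<close> refers to \<open>\<phi>\<close> only through its GNS
  representation. A definition cannot quantify over the type carrying the Hilbert space, so
  the GNS data \<open>\<pi>, \<xi>\<close> of \<open>\<phi>\<close> are passed as arguments.\<close>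

definition strong_dilation :: "'a::unital_cstar_algebra set
    \<Rightarrow> ('a \<Rightarrow> complex) \<Rightarrow> ('a \<Rightarrow> 'h \<Rightarrow> 'h) \<Rightarrow> 'h::complex_hilbert_space
    \<Rightarrow> ('a \<Rightarrow> complex) \<Rightarrow> bool" where
  "strong_dilation S \<phi> \<pi> \<xi> \<psi> \<longleftrightarrow> state \<phi> \<and> gns_representation \<phi> \<pi> \<xi> \<and> state \<psi> \<and>
     (\<exists>\<Phi>. ucp_into (bicommutant (range \<pi>)) \<Phi> \<and> (\<forall>s\<in>S. \<Phi> s = \<pi> s)
        \<and> (\<forall>a. \<psi> a = cinner (\<Phi> a \<xi>) \<xi>))"

definition strong_dilation_maximal :: "'a::unital_cstar_algebra set
    \<Rightarrow> ('a \<Rightarrow> complex) \<Rightarrow> ('a \<Rightarrow> 'h \<Rightarrow> 'h) \<Rightarrow> 'h::complex_hilbert_space \<Rightarrow> bool" where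
  "strong_dilation_maximal S \<phi> \<pi> \<xi> \<longleftrightarrow>
     (\<forall>\<psi>. state \<psi> \<longrightarrow> strong_dilation S \<phi> \<pi> \<xi> \<psi> \<longrightarrow> \<psi> = \<phi>)"

end

theory Submission
  imports Defs
begin

text \<open>
  Let \<open>\<Phi>\<close> be a tight extension of \<open>\<pi>|\<^sub>S\<close>. If \<open>\<phi>\<close> is maximal, then
  \<open>\<langle>\<Phi>(a)\<xi>, \<xi>\<rangle> = \<phi>(a)\<close> for all \<open>a\<close>. Let \<open>B\<close> be the set of all \<open>b\<close> with \<open>\<Phi>(b)\<xi> = \<pi>(b)\<xi>\<close>. For
  \<open>b \<in> B\<close> the vectors \<open>b \<otimes> \<xi>\<close> and \<open>1 \<otimes> \<pi>(b)\<xi>\<close> of the Stinespring space of \<open>\<Phi>\<close> have distance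
  zero, since \<open>\<langle>\<Phi>(b\<^sup>*b)\<xi>, \<xi>\<rangle> = \<parallel>\<pi>(b)\<xi>\<parallel>\<^sup>2\<close>; hence \<open>\<Phi>(ab)\<xi> = \<Phi>(a)\<pi>(b)\<xi>\<close> for all \<open>a\<close>. Taking \<open>a \<in> S\<close>
  shows \<open>S B \<subseteq> B\<close>. As \<open>B\<close> is a closed subspace that contains \<open>1\<close>, it follows that \<open>B = A\<close>, so that
  \<open>\<Phi>(a)\<close> and \<open>\<pi>(a)\<close> agree on the dense subspace \<open>\<pi>(A)\<xi>\<close>.
\<close>

section \<open>Complex scalars and inner products\<close>

lemma scaleC_zero_right [simp]: "c *\<^sub>C 0 = (0::'a::complex_normed_space)"
  using scaleC_add_right[of c 0 0] by simp

lemma scaleC_diff_right: "c *\<^sub>C (x - y) = c *\<^sub>C x - c *\<^sub>C (y::'a::complex_normed_space)"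
  by (metis scaleC_add_right add_diff_cancel_right' diff_add_cancel)

lemma cinner_add_right: "cinner x (y + z) = cinner x y + cinner x (z::'a::complex_hilbert_space)"
  by (metis cinner_add_left cinner_commute complex_cnj_add)

lemma cinner_scaleC_right: "cinner x (c *\<^sub>C y) = cnj c * cinner x (y::'a::complex_hilbert_space)"
  by (metis cinner_scaleC_left cinner_commute complex_cnj_mult)

lemma cinner_scaleR_left: "cinner (r *\<^sub>R x) y = of_real r * cinner x (y::'a::complex_hilbert_space)"
  by (metis cinner_scaleC_left scaleC_of_real)

lemma cinner_scaleR_right: "cinner x (r *\<^sub>R y) = of_real r * cinner x (y::'a::complex_hilbert_space)"
  by (metis cinner_scaleC_right scaleC_of_real complex_cnj_complex_of_real)

lemma cinner_zero_left [simp]: "cinner 0 y = (0::complex)" for y :: "'a::complex_hilbert_space"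
  using cinner_add_left[of 0 0 y] by simp

lemma cinner_zero_right [simp]: "cinner y 0 = (0::complex)" for y :: "'a::complex_hilbert_space"
  using cinner_add_right[of y 0 0] by simp

lemma cinner_minus_left: "cinner (- x) y = - cinner x (y::'a::complex_hilbert_space)"
  using cinner_scaleR_left[of "-1" x y] by simp

lemma cinner_minus_right: "cinner x (- y) = - cinner x (y::'a::complex_hilbert_space)"
  using cinner_scaleR_right[of x "-1" y] by simp

lemma cinner_diff_left: "cinner (x - y) z = cinner x z - cinner y (z::'a::complex_hilbert_space)"
  using cinner_add_left[of x "- y" z] by (simp add: cinner_minus_left)

lemma clinear_add: "clinear f \<Longrightarrow> f (x + y) = f x + f y"
  and clinear_scaleC: "clinear f \<Longrightarrow> f (c *\<^sub>C x) = c *\<^sub>C f x"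
  by (auto simp: clinear_def)

lemma clinear_imp_linear: "clinear f \<Longrightarrow> linear f"
  by (rule linearI) (metis clinear_add, metis clinear_scaleC scaleC_of_real)

lemma bounded_op_imp_bounded_linear:
  assumes "bounded_op T"
  shows "bounded_linear T"
proof -
  obtain K where "clinear T" "\<And>x. norm (T x) \<le> K * norm x"
    using assms by (auto simp: bounded_op_def)
  then show ?thesis
    by (intro bounded_linear.intro bounded_linear_axioms.intro)
      (auto simp: clinear_imp_linear mult.commute)
qed

section \<open>States are contractive\<close>

lemma star_one [simp]: "star 1 = (1::'a::unital_cstar_algebra)"
  by (metis mult_1 mult_1_right star_mult star_star)

lemma star_zero [simp]: "star 0 = (0::'a::unital_cstar_algebra)"
  using star_add[of 0 "0::'a"] by simp

text \<open>The C*-identity and submultiplicativity bound \<open>(norm y)\<^sup>2\<close> by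
  \<open>norm (star y) * norm y\<close>. Cancelling gives one inequality, and applying it to
  \<open>star x\<close> gives the other.\<close>

lemma norm_star [simp]: "norm (star x) = norm (x::'a::unital_cstar_algebra)"
proof -
  have le: "norm y \<le> norm (star y)" for y :: 'a
  proof (cases "y = 0")
    case False
    have "norm y * norm y \<le> norm (star y) * norm y"
      using cstar_identity[of y] norm_mult_ineq[of "star y" y] by (simp add: power2_eq_square)
    then show ?thesis
      using False by simp
  qed simp
  show ?thesis
    using le[of x] le[of "star x"] by (simp add: star_star)
qed

lemma bounded_linear_star: "bounded_linear (star :: 'a::unital_cstar_algebra \<Rightarrow> 'a)"
proof (rule bounded_linear_intro[where K = 1])
  show "star (r *\<^sub>R x) = r *\<^sub>R star x" for r and x :: 'a
    using star_scaleC[of "of_real r" x] by (simp add: scaleC_of_real)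
qed (auto simp: star_add)

lemma selfadjoint_power: "star x = x \<Longrightarrow> star (x ^ n) = (x::'a::unital_cstar_algebra) ^ n"
  by (induction n) (simp_all add: star_mult power_commutes)

lemma summable_gbinomial_half:
  assumes "\<bar>x\<bar> < (1::real)"
  shows "summable (\<lambda>n. \<bar>(1/2 gchoose n)\<bar> * \<bar>x\<bar> ^ n)"
proof -
  have "\<bar>(1/2 gchoose n) :: real\<bar> \<le> 1" for n
  proof (induction n)
    case (Suc n)
    \<comment> \<open>Since \<open>\<bar>1/2 - real n\<bar>\<close> is at most
      \<open>real (Suc n)\<close>, this recursion keeps the coefficients bounded by 1, and the
      geometric series dominates.\<close>
    have "real (Suc n) * (1/2 gchoose Suc n) = (1/2 - real n) * (1/2 gchoose n)"
      by (metis gbinomial_absorption gbinomial_absorb_comp)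
    then have "real (Suc n) * \<bar>1/2 gchoose Suc n\<bar> = \<bar>1/2 - real n\<bar> * \<bar>1/2 gchoose n\<bar>"
      by (metis abs_mult abs_of_nat)
    also have "\<dots> \<le> real (Suc n) * 1"
      by (intro mult_mono) (use Suc in auto)
    finally show ?case
      by simp
  qed simp
  then show ?thesis
    by (intro summable_comparison_test[OF _ summable_geometric[of "\<bar>x\<bar>"]] exI[of _ 0])
      (auto simp: assms intro!: mult_left_le_one_le)
qed

text \<open>The square root is the binomial series of exponent 1/2 in \<open>- y\<close>, absolutely
  convergent because \<open>norm y < 1\<close>. Its real coefficients make it selfadjoint.\<close>

lemma selfadjoint_sqrt_one_minus:
  fixes y :: "'a::unital_cstar_algebra"
  assumes "norm y < 1" and "star y = y"
  obtains x where "star x = x" and "x * x = 1 - y"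
proof -
  define f where "f n = (1/2 gchoose n) *\<^sub>R (- y) ^ n" for n
  have summable: "summable (\<lambda>n. norm (f n))"
  proof (rule summable_comparison_test)
    show "summable (\<lambda>n. \<bar>1/2 gchoose n\<bar> * norm y ^ n)"
      using summable_gbinomial_half[of "norm y"] assms(1) by simp
    have "norm (f n) \<le> \<bar>1/2 gchoose n\<bar> * norm y ^ n" for n
      using norm_power_ineq[of "- y" n] by (auto simp: f_def intro!: mult_left_mono)
    then show "\<exists>N. \<forall>n\<ge>N. norm (norm (f n)) \<le> \<bar>1/2 gchoose n\<bar> * norm y ^ n"
      by simp
  qed
  have star_power: "star ((- y) ^ n) = (- y) ^ n" for n
    by (rule selfadjoint_power)
      (simp add: assms(2) linear_neg[OF bounded_linear.linear[OF bounded_linear_star]])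
  have "star (suminf f) = (\<Sum>n. star (f n))"
    using bounded_linear.suminf[OF bounded_linear_star summable_norm_cancel[OF summable]] by simp
  also have "(\<lambda>n. star (f n)) = f"
    by (auto simp: f_def star_power linear_cmul[OF bounded_linear.linear[OF bounded_linear_star]])
  finally have selfadjoint: "star (suminf f) = suminf f" .
  \<comment> \<open>Squaring the series is a Cauchy product; Vandermonde's identity adds the
    exponents, 1/2 + 1/2 = 1, so only the terms for \<open>k = 0\<close> and \<open>k = 1\<close>
    survive.\<close>
  have "(\<Sum>i\<le>k. f i * f (k - i)) = (1 gchoose k) *\<^sub>R (- y) ^ k" for k
  proof -
    have "(\<Sum>i\<le>k. f i * f (k - i))
        = (\<Sum>i\<le>k. ((1/2 gchoose i) * (1/2 gchoose (k - i))) *\<^sub>R (- y) ^ k)"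
      by (intro sum.cong) (auto simp: f_def mult.commute simp flip: power_add)
    also have "\<dots> = (1 gchoose k) *\<^sub>R (- y) ^ k"
      using gbinomial_Vandermonde[of "1/2::real" "1/2" k]
      by (simp add: atLeast0AtMost flip: scaleR_sum_left)
    finally show ?thesis .
  qed
  moreover have "(\<lambda>k. \<Sum>i\<le>k. f i * f (k - i)) sums (suminf f * suminf f)"
    by (rule Cauchy_product_sums[OF summable summable])
  ultimately have "(\<lambda>k. ((1::real) gchoose k) *\<^sub>R (- y) ^ k) sums (suminf f * suminf f)"
    by simp
  moreover have "(\<lambda>k. ((1::real) gchoose k) *\<^sub>R (- y) ^ k) sums
      (\<Sum>k\<in>{0, 1}. ((1::real) gchoose k) *\<^sub>R (- y) ^ k)"
  proof (rule sums_finite)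
    fix n :: nat
    assume "n \<notin> {0, 1}"
    then have "1 choose n = 0"
      by (intro binomial_eq_0) auto
    then have "(1::real) gchoose n = 0"
      by (metis binomial_gbinomial of_nat_0 of_nat_1)
    then show "((1::real) gchoose n) *\<^sub>R (- y) ^ n = 0"
      by simp
  qed simp
  ultimately have "suminf f * suminf f = 1 - y"
    using sums_unique2 by fastforce
  with selfadjoint show thesis
    by (rule that)
qed

text \<open>States are nonnegative on elements \<open>star x * x\<close> by definition, so
  \<open>(norm a)\<^sup>2 + e - star a * a\<close> is written, up to a positive factor, as the
  square of a selfadjoint element.\<close>

lemma state_star_mult_le:
  assumes "state \<phi>"
  shows "Re (\<phi> (star a * a)) \<le> (norm a)\<^sup>2"
proof (rule field_le_epsilon)
  fix e :: real
  assume "0 < e"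
  \<comment> \<open>The slack \<open>e\<close> makes the rescaled element \<open>y\<close> have norm
    strictly below 1, also when \<open>a = 0\<close>.\<close>
  define r where "r = (norm a)\<^sup>2 + e"
  have "r > 0"
    using \<open>0 < e\<close> by (simp add: r_def add_nonneg_pos)
  have lin: "linear \<phi>" and pos: "\<And>a. \<phi> (star a * a) \<in> \<real>\<^sub>\<ge>\<^sub>0" and one: "\<phi> 1 = 1"
    using assms by (auto simp: state_def clinear_imp_linear)
  define y where "y = (1 / r) *\<^sub>R (star a * a)"
  have "norm y < 1"
    using \<open>r > 0\<close> \<open>0 < e\<close> by (simp add: y_def cstar_identity) (simp add: r_def)
  moreover have "star y = y"
    by (simp add: y_def linear_cmul[OF bounded_linear.linear[OF bounded_linear_star]] star_mult star_star)
  ultimately obtain x where "star x = x" "x * x = 1 - y"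
    by (rule selfadjoint_sqrt_one_minus)
  then have "Re (\<phi> (1 - y)) \<ge> 0"
    using pos[of x] by (simp add: complex_nonneg_Reals_iff)
  then have "Re (\<phi> (star a * a)) / r \<le> 1"
    by (simp add: linear_diff[OF lin] one y_def linear_cmul[OF lin])
  then show "Re (\<phi> (star a * a)) \<le> (norm a)\<^sup>2 + e"
    using \<open>r > 0\<close> by (simp add: divide_simps r_def)
qed

section \<open>Unital completely positive maps\<close>

lemma ucp_bounded_op: "ucp_into M \<Phi> \<Longrightarrow> bounded_op (\<Phi> a)"
  and ucp_clinear: "ucp_into M \<Phi> \<Longrightarrow> clinear (\<lambda>a. \<Phi> a h)"
  and ucp_one: "ucp_into M \<Phi> \<Longrightarrow> \<Phi> 1 = id"
  by (auto simp: ucp_into_def linear_into_ops_def)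

lemma ucp_linear_op: "ucp_into M \<Phi> \<Longrightarrow> linear (\<Phi> a)"
  using ucp_bounded_op[of M \<Phi> a] by (simp add: bounded_op_def clinear_imp_linear)

lemma ucp_form_nonneg:
  assumes "ucp_into M \<Phi>"
  shows "(\<Sum>i<n::nat. cinner (\<Sum>j<n. \<Phi> (star (b i) * b j) (h j)) (h i)) \<in> \<real>\<^sub>\<ge>\<^sub>0"
proof -
  \<comment> \<open>Factorization through a single row: \<open>X\<close> has first row
    \<open>b\<close> and is zero elsewhere, since \<open>matrix_positive\<close> asks for a square
    factor.\<close>
  define X where "X k = (if k = 0 then b else (\<lambda>i. 0))" for k :: nat
  have "star (b i) * b j = (\<Sum>k<n. star (X k i) * X k j)" if "i < n" for i j
    using that by (subst sum.remove[of _ 0]) (auto simp: X_def intro!: sum.neutral)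
  then have "matrix_positive n (\<lambda>i j. star (b i) * b j)"
    unfolding matrix_positive_def by blast
  then show ?thesis
    using assms by (simp add: ucp_into_def op_matrix_positive_def)
qed

lemma ucp_form_nonneg2:
  assumes "ucp_into M \<Phi>"
  shows "cinner (\<Phi> (star a * a) x) x + cinner (\<Phi> (star a) y) x
    + cinner (\<Phi> a x) y + cinner y y \<in> \<real>\<^sub>\<ge>\<^sub>0"
  using ucp_form_nonneg[OF assms, where n = "Suc (Suc 0)"
      and b = "\<lambda>i. if i = 0 then a else 1" and h = "\<lambda>i. if i = 0 then x else y"]
  by (simp add: cinner_add_left ucp_one[OF assms] add_ac)

text \<open>Positivity forces the form to be real, so the two cross terms have opposite imaginary
  parts. Replacing \<open>y\<close> by \<open>\<i> *\<^sub>C y\<close> compares their real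
  parts.\<close>

lemma ucp_star:
  assumes "ucp_into M \<Phi>"
  shows "cinner (\<Phi> (star a) y) x = cinner y (\<Phi> a x)"
proof -
  have *: "Im (cinner (\<Phi> (star a) y) x + cinner (\<Phi> a x) y) = 0" for x y
    using ucp_form_nonneg2[OF assms, of a x y] ucp_form_nonneg2[OF assms, of a x 0]
    by (simp add: complex_nonneg_Reals_iff cinner_self linear_0[OF ucp_linear_op[OF assms]])
  have "clinear (\<Phi> (star a))"
    using ucp_bounded_op[OF assms] by (simp add: bounded_op_def)
  then show ?thesis
    using *[where x = x and y = y] *[where x = x and y = "\<i> *\<^sub>C y"] cinner_commute[of "\<Phi> a x" y]
    by (simp add: clinear_scaleC cinner_scaleC_left cinner_scaleC_right complex_eq_iff)
qed

text \<open>Kadison-Schwarz inequality, from the two-vector form at \<open>y = - \<Phi> a x\<close>: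
  the Stinespring vector a \<otimes> x - 1 \<otimes> \<Phi>(a)x has nonnegative squared
  length.\<close>

lemma ucp_schwarz:
  assumes "ucp_into M \<Phi>"
  shows "(norm (\<Phi> a x))\<^sup>2 \<le> Re (cinner (\<Phi> (star a * a) x) x)"
  using ucp_form_nonneg2[OF assms, of a x "- \<Phi> a x"]
  by (simp add: complex_nonneg_Reals_iff ucp_star[OF assms] cinner_self
      cinner_minus_left cinner_minus_right)

text \<open>The hypothesis says that \<open>b \<otimes> x - 1 \<otimes> \<Phi>(b)x\<close> is a null vector of the Stinespring form.\<close>

lemma ucp_mult_if_schwarz_eq:
  assumes ucp: "ucp_into M \<Phi>"
    and eq: "cinner (\<Phi> (star b * b) x) x = (norm (\<Phi> b x))\<^sup>2"
  shows "\<Phi> (a * b) x = \<Phi> a (\<Phi> b x)"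
proof (rule ccontr)
  define d where "d = \<Phi> (a * b) x - \<Phi> a (\<Phi> b x)"
  assume "\<Phi> (a * b) x \<noteq> \<Phi> a (\<Phi> b x)"
  then have "(norm d)\<^sup>2 > 0"
    by (simp add: d_def)
  define c where "c = Re (cinner (\<Phi> (a * star a) d) d)"
  have "0 \<le> t\<^sup>2 * c - 2 * t * (norm d)\<^sup>2" for t
  proof -
    have lin: "linear (\<Phi> a)" for a
      by (rule ucp_linear_op[OF ucp])
    have d1: "cinner d d = cinner (\<Phi> (a * b) x) d - cinner (\<Phi> a (\<Phi> b x)) d"
      by (simp add: d_def cinner_diff_left)
    have adj1: "cinner (\<Phi> (star b) v) x = cinner v (\<Phi> b x)" for v
      by (rule ucp_star[OF ucp])
    have adj2: "cinner (\<Phi> (star b * star a) v) x = cinner v (\<Phi> (a * b) x)" for v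
      using ucp_star[OF ucp, of "a * b" v x] by (simp add: star_mult)
    have adj3: "cinner (\<Phi> (star a) v) w = cinner v (\<Phi> a w)" for v w
      by (rule ucp_star[OF ucp])
    have d2: "cinner d d = cinner d (\<Phi> (a * b) x) - cinner d (\<Phi> a (\<Phi> b x))"
      by (metis d1 cinner_commute complex_cnj_diff)
    \<comment> \<open>This is the squared length of b \<otimes> x - 1 \<otimes> \<Phi>(b)x - t(a*
      \<otimes> d). The terms without \<open>t\<close> cancel by \<open>eq\<close>, and each of the
      two cross terms is -t times \<open>cinner d d\<close>.\<close>
    have "0 \<le> Re (cinner (\<Phi> (star b * b) x) x - cinner (\<Phi> b x) (\<Phi> b x)
        - cinner (\<Phi> b x) (\<Phi> b x) + cinner (\<Phi> b x) (\<Phi> b x)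
        - t * (cinner (\<Phi> (a * b) x) d - cinner (\<Phi> a (\<Phi> b x)) d)
        - t * (cinner d (\<Phi> (a * b) x) - cinner d (\<Phi> a (\<Phi> b x)))
        + t\<^sup>2 * cinner (\<Phi> (a * star a) d) d)"
      using ucp_form_nonneg[OF ucp, where n = "Suc (Suc (Suc 0))"
          and b = "\<lambda>i. if i = 0 then b else if i = 1 then 1 else star a"
          and h = "\<lambda>i. if i = 0 then x else if i = 1 then - \<Phi> b x else - (t *\<^sub>R d)"]
      by (simp add: complex_nonneg_Reals_iff cinner_add_left cinner_diff_left ucp_one[OF ucp] star_star
          linear_neg[OF lin] linear_cmul[OF lin] cinner_minus_left cinner_minus_right
          cinner_scaleR_left cinner_scaleR_right adj1 adj2 adj3 algebra_simps power2_eq_square)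
    then show ?thesis
      unfolding d1[symmetric] d2[symmetric]
      by (simp add: eq cinner_self c_def flip: of_real_mult of_real_power)
  qed
  \<comment> \<open>A quadratic in \<open>t\<close> with no constant term and negative slope at 0 is
    negative for small positive \<open>t\<close>. The denominator is positive and exceeds
    \<open>c\<close>, which makes this \<open>t\<close> small enough.\<close>
  from this[of "(norm d)\<^sup>2 / (\<bar>c\<bar> + 1)"]
  have "2 * ((norm d)\<^sup>2)\<^sup>2 * (\<bar>c\<bar> + 1) \<le> ((norm d)\<^sup>2)\<^sup>2 * c"
    by (simp add: divide_simps power2_eq_square mult_ac split: if_splits)
  with \<open>(norm d)\<^sup>2 > 0\<close> show False
    by (simp add: mult.assoc)
qed

lemma state_ucp_vector:
  assumes ucp: "ucp_into M \<Phi>" and "norm x = 1"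
  shows "state (\<lambda>a. cinner (\<Phi> a x) x)"
proof -
  have "cinner (\<Phi> (star a * a) x) x \<in> \<real>\<^sub>\<ge>\<^sub>0" for a
    using ucp_form_nonneg[OF ucp, where n = 1 and b = "\<lambda>i. a" and h = "\<lambda>i. x"] by simp
  then show ?thesis
    using assms(2) ucp_clinear[OF ucp]
    by (auto simp: state_def clinear_def ucp_one[OF ucp] cinner_self cinner_add_left
        cinner_scaleC_left scaleC_complex_def)
qed

text \<open>The left multipliers of \<open>B\<close> whose adjoints are also left multipliers form a
  C*-subalgebra containing \<open>S\<close>, hence everything; multiplying \<open>1 \<in> B\<close>
  then yields all elements.\<close>

lemma left_invariant_eq_UNIV:
  fixes B :: "'a::unital_cstar_algebra set"
  assumes S: "operator_system S" "cstar_generated S = UNIV"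
    and B: "csubspace B" "closed B" "1 \<in> B"
    and mult: "\<And>s b. s \<in> S \<Longrightarrow> b \<in> B \<Longrightarrow> s * b \<in> B"
  shows "B = UNIV"
proof -
  define C where "C = {c. \<forall>b\<in>B. c * b \<in> B \<and> star c * b \<in> B}"
  have [continuous_intros]: "continuous_on UNIV (\<lambda>c. star c :: 'a)"
    by (rule linear_continuous_on[OF bounded_linear_star])
  have "C = (\<Inter>b\<in>B. (\<lambda>c. c * b) -` B \<inter> (\<lambda>c. star c * b) -` B)"
    by (auto simp: C_def)
  then have "closed C"
    by (auto intro!: closed_INT closed_Int closed_vimage[OF B(2)] continuous_intros)
  moreover have "csubspace C"
    using B(1) by (auto simp: C_def csubspace_def distrib_right star_add star_scaleC mult_scaleC_left)
  ultimately have "cstar_subalgebra C"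
    by (auto simp: cstar_subalgebra_def C_def star_mult star_star mult.assoc)
  moreover have "S \<subseteq> C"
    using S(1) mult by (auto simp: C_def operator_system_def)
  ultimately have "C = UNIV"
    using S(2) by (auto simp: cstar_generated_def)
  then show ?thesis
    using B(3) by (metis (mono_tags, lifting) C_def UNIV_eq_I UNIV_I mem_Collect_eq mult_1_right)
qed

section \<open>Maximality and unique tight extensions\<close>

lemma tight_extension_eq_if_vector_state_eq:
  fixes S :: "'a::unital_cstar_algebra set"
    and \<pi> :: "'a \<Rightarrow> 'h::complex_hilbert_space \<Rightarrow> 'h"
  assumes S: "operator_system S" "cstar_generated S = UNIV"
    and \<phi>: "state \<phi>" and gns: "gns_representation \<phi> \<pi> \<xi>"
    and ucp: "ucp_into M \<Phi>" and tight: "\<And>s. s \<in> S \<Longrightarrow> \<Phi> s = \<pi> s"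
    and vector_state: "\<And>a. cinner (\<Phi> a \<xi>) \<xi> = \<phi> a"
  shows "\<Phi> = \<pi>"
proof -
  have \<pi>_bounded: "bounded_op (\<pi> a)" and \<pi>_clinear: "clinear (\<lambda>a. \<pi> a h)" and \<pi>_one: "\<pi> 1 = id"
    and \<pi>_mult: "\<pi> (a * b) h = \<pi> a (\<pi> b h)"
    and \<pi>_star: "cinner (\<pi> a h) k = cinner h (\<pi> (star a) k)"
    and \<phi>_eq: "\<phi> a = cinner (\<pi> a \<xi>) \<xi>"
    and cyclic: "closure (range (\<lambda>a. \<pi> a \<xi>)) = UNIV" for a b h k
    using gns by (auto simp: gns_representation_def representation_def linear_into_ops_def)
  have \<phi>_star_mult: "\<phi> (star a * a) = (norm (\<pi> a \<xi>))\<^sup>2" for a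
    by (simp only: \<phi>_eq \<pi>_mult \<pi>_star star_star cinner_self)
  \<comment> \<open>Contractivity of states enters here; it makes \<open>\<Delta>\<close> continuous
    and thereby \<open>B\<close> closed.\<close>
  have norm_\<pi>: "norm (\<pi> a \<xi>) \<le> norm a" for a
    using state_star_mult_le[OF \<phi>, of a] by (simp add: \<phi>_star_mult)
  have "(norm (\<Phi> a \<xi>))\<^sup>2 \<le> (norm (\<pi> a \<xi>))\<^sup>2" for a
    using ucp_schwarz[OF ucp, of a \<xi>] by (simp add: vector_state \<phi>_star_mult)
  then have norm_\<Phi>: "norm (\<Phi> a \<xi>) \<le> norm (\<pi> a \<xi>)" for a
    by (rule power2_le_imp_le) simp
  define \<Delta> where "\<Delta> a = \<Phi> a \<xi> - \<pi> a \<xi>" for a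
  have \<Delta>_clinear: "clinear \<Delta>"
    using ucp_clinear[OF ucp, of \<xi>] \<pi>_clinear[of \<xi>]
    by (simp add: clinear_def \<Delta>_def scaleC_diff_right)
  moreover have "norm (\<Delta> a) \<le> norm a * 2" for a
    using norm_triangle_ineq4[of "\<Phi> a \<xi>" "\<pi> a \<xi>"] norm_\<Phi>[of a] norm_\<pi>[of a]
    by (simp add: \<Delta>_def)
  ultimately have \<Delta>_bounded: "bounded_linear \<Delta>"
    by (intro bounded_linear.intro bounded_linear_axioms.intro) (auto intro: clinear_imp_linear)
  define B where "B = {b. \<Delta> b = 0}"
  have \<Phi>_mult: "\<Phi> (a * b) \<xi> = \<Phi> a (\<pi> b \<xi>)" if "b \<in> B" for a b
  proof -
    have "\<Phi> b \<xi> = \<pi> b \<xi>"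
      using that by (simp add: B_def \<Delta>_def)
    \<comment> \<open>For \<open>b \<in> B\<close> the Schwarz inequality is an equality at
      \<open>\<xi>\<close>, as both sides equal
      \<open>(norm (\<pi> b \<xi>))\<^sup>2\<close>.\<close>
    moreover from this have "cinner (\<Phi> (star b * b) \<xi>) \<xi> = (norm (\<Phi> b \<xi>))\<^sup>2"
      by (simp add: vector_state \<phi>_star_mult)
    ultimately show ?thesis
      using ucp_mult_if_schwarz_eq[OF ucp] by metis
  qed
  have "B = UNIV"
  proof (rule left_invariant_eq_UNIV[OF S])
    show "csubspace B"
      using \<Delta>_clinear linear_0[OF clinear_imp_linear[OF \<Delta>_clinear]]
      by (auto simp: csubspace_def B_def clinear_add clinear_scaleC)
    show "closed B"
      unfolding B_def
      by (intro closed_Collect_eq linear_continuous_on[OF \<Delta>_bounded] continuous_on_const)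
    show "1 \<in> B"
      by (simp add: B_def \<Delta>_def ucp_one[OF ucp] \<pi>_one)
    \<comment> \<open>\<Phi>(sb)\<xi> = \<Phi>(s)\<pi>(b)\<xi> = \<pi>(s)\<pi>(b)\<xi> =
      \<pi>(sb)\<xi>, where the middle equality is tightness.\<close>
    show "s * b \<in> B" if "s \<in> S" "b \<in> B" for s b
      using \<Phi>_mult[OF that(2), of s] tight[OF that(1)] by (simp add: B_def \<Delta>_def \<pi>_mult)
  qed
  show ?thesis
  proof (intro ext)
    fix a h
    have "closed {h. \<Phi> a h = \<pi> a h}"
      by (intro closed_Collect_eq linear_continuous_on bounded_op_imp_bounded_linear
          ucp_bounded_op[OF ucp] \<pi>_bounded)
    \<comment> \<open>Membership of \<open>b\<close> gives \<Phi>(a)\<pi>(b)\<xi> = \<Phi>(ab)\<xi>,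
      and membership of \<open>a * b\<close> turns this into \<pi>(ab)\<xi>.\<close>
    moreover have "\<Phi> a (\<pi> b \<xi>) = \<pi> a (\<pi> b \<xi>)" for b
    proof -
      have "b \<in> B" "a * b \<in> B"
        using \<open>B = UNIV\<close> by auto
      then show ?thesis
        using \<Phi>_mult[of b a] by (simp add: B_def \<Delta>_def \<pi>_mult)
    qed
    ultimately have "closure (range (\<lambda>b. \<pi> b \<xi>)) \<subseteq> {h. \<Phi> a h = \<pi> a h}"
      by (intro closure_minimal) auto
    then show "\<Phi> a h = \<pi> a h"
      using cyclic by auto
  qed
qed

theorem theoremA:
  fixes S :: "'a::unital_cstar_algebra set"
    and \<phi> :: "'a \<Rightarrow> complex"
    and \<pi> :: "'a \<Rightarrow> 'h::complex_hilbert_space \<Rightarrow> 'h"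
    and \<xi> :: 'h
  assumes "separable_type TYPE('a)"
    and "operator_system S"
    and "cstar_generated S = UNIV"
    and "state \<phi>"
    and "gns_representation \<phi> \<pi> \<xi>"
  shows "unique_tight_extension S \<pi> \<longleftrightarrow> strong_dilation_maximal S \<phi> \<pi> \<xi>"
proof
  assume "unique_tight_extension S \<pi>"
  \<comment> \<open>The easy direction: every dilation map is \<open>\<pi>\<close> itself, so the
    dilated state is the vector state of \<open>\<pi>\<close> at \<open>\<xi>\<close>, that is
    \<open>\<phi>\<close>.\<close>
  then have "cinner (\<Phi> a \<xi>) \<xi> = \<phi> a"
    if "ucp_into (bicommutant (range \<pi>)) \<Phi>" "\<forall>s\<in>S. \<Phi> s = \<pi> s" for \<Phi> a
    using that assms(5) by (auto simp: unique_tight_extension_def gns_representation_def)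
  then show "strong_dilation_maximal S \<phi> \<pi> \<xi>"
    by (fastforce simp: strong_dilation_maximal_def strong_dilation_def)
next
  assume maximal: "strong_dilation_maximal S \<phi> \<pi> \<xi>"
  \<comment> \<open>Evaluating \<open>\<phi>\<close> at 1 shows that \<open>\<xi>\<close> is a unit
    vector, so that its functional under \<open>\<Phi>\<close> is a state to which maximality
    applies.\<close>
  have "(norm \<xi>)\<^sup>2 = 1"
  proof -
    have "cinner \<xi> \<xi> = 1"
      using assms(4,5)
      by (metis gns_representation_def representation_def state_def id_apply)
    then show ?thesis
      by (metis cinner_self of_real_eq_1_iff)
  qed
  then have "norm \<xi> = 1"
    by (simp add: power2_eq_1_iff) (use norm_ge_zero[of \<xi>] in linarith)
  have "\<Phi> = \<pi>" if ucp: "ucp_into (bicommutant (range \<pi>)) \<Phi>" and tight: "\<forall>s\<in>S. \<Phi> s = \<pi> s" for \<Phi>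
  proof (rule tight_extension_eq_if_vector_state_eq[OF assms(2-5) ucp])
    show "\<Phi> s = \<pi> s" if "s \<in> S" for s
      using tight that by blast
    have "state (\<lambda>a. cinner (\<Phi> a \<xi>) \<xi>)"
      using ucp \<open>norm \<xi> = 1\<close> by (rule state_ucp_vector)
    then have "(\<lambda>a. cinner (\<Phi> a \<xi>) \<xi>) = \<phi>"
      using maximal ucp tight assms(4,5)
      unfolding strong_dilation_maximal_def strong_dilation_def by blast
    then show "cinner (\<Phi> a \<xi>) \<xi> = \<phi> a" for a
      by metis
  qed
  then show "unique_tight_extension S \<pi>"
    by (auto simp: unique_tight_extension_def)
qed

end
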